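(* Let $N\ge 1$ be an integer, let $\mathcal{K}$ be a simplicial complex in $\mathbb{R}^N$, and let $X$ be a topological space. A map $f\colon|\mathcal{K}|\to X$ is continuous if and only if the restriction $f|_\sigma\colon\sigma\to X$ is continuous for each $\sigma\in\mathcal{K}$.
   Context: Points $\mathbf{a}_0,\ldots,\mathbf{a}_n$ of $\mathbb{R}^N$ are geometrically independent if for all real scalars $t_i$, the equations $\sum_i t_i=0$ and $\sum_i t_i\mathbf{a}_i=\mathbf{0}$ imply $t_i=0$ for all $i$. The simplex spanned by such points (its vertices) is $\{\sum_{i=0}^n t_i\mathbf{a}_i : t_i\ge 0,\ \sum_i t_i=1\}$, with the subspace topology from $\mathbb{R}^N$. A face of a simplex is a simplex spanned by a non-empty subset of its vertices (possibly all of them). A simplicial complex in $\mathbb{R}^N$ is a non-empty, possibly infinite, collection $\mathcal{K}$ of simplices in $\mathbb{R}^N$ such that every face of a simplex of $\mathcal{K}$ is in $\mathcal{K}$, and for all $\sigma,\tau\in\mathcal{K}$ the intersection $\sigma\cap\tau$ is either empty or a face of both. The underlying space is $|\mathcal{K}|=\bigcup_{\sigma\in\mathcal{K}}\sigma$, with the topology in which $U\subset|\mathcal{K}|$ is open if and only if $U\cap\sigma$ is open in $\sigma$ for every $\sigma\in\mathcal{K}$. *)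

theory Defs
  imports "HOL-Analysis.Analysis"
begin

text \<open>
  Simplices are those of the library: \<^term>\<open>int n simplex S\<close> says that \<open>S\<close> is the convex hull of
  \<open>n + 1\<close> affinely independent points. The next lemma spells this out in terms of geometric
  independence and barycentric coordinates. Geometrically independent points are pairwise distinct,
  so a list of vertices can be replaced by the set of vertices.
\<close>

lemma simplex_iff_geometrically_independent:
  fixes S :: "'a::euclidean_space set"
  shows "(\<exists>n::nat. int n simplex S) \<longleftrightarrow>
    (\<exists>C. finite C \<and> C \<noteq> {} \<and>
      (\<forall>t::'a \<Rightarrow> real. (\<Sum>a\<in>C. t a) = 0 \<and> (\<Sum>a\<in>C. t a *\<^sub>R a) = 0 \<longrightarrow> (\<forall>a\<in>C. t a = 0)) \<and>
      S = {\<Sum>a\<in>C. t a *\<^sub>R a | t::'a \<Rightarrow> real. (\<forall>a\<in>C. t a \<ge> 0) \<and> (\<Sum>a\<in>C. t a) = 1})"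
    (is "?L \<longleftrightarrow> (\<exists>C. finite C \<and> C \<noteq> {} \<and> ?I C \<and> S = ?H C)")
proof -
  have I: "\<not> affine_dependent C \<longleftrightarrow> ?I C" if "finite C" for C :: "'a set"
    by (subst affine_dependent_explicit_finite[OF that]) blast
  have H: "convex hull C = ?H C" if "finite C" for C :: "'a set"
    by (subst convex_hull_finite[OF that]) blast
  have "?L \<longleftrightarrow> (\<exists>C. finite C \<and> C \<noteq> {} \<and> \<not> affine_dependent C \<and> S = convex hull C)"
  proof
    assume ?L
    then show "\<exists>C. finite C \<and> C \<noteq> {} \<and> \<not> affine_dependent C \<and> S = convex hull C"
      unfolding simplex
    proof (elim exE conjE)
      fix n C
      assume C: "finite C" "\<not> affine_dependent C" "int (card C) = int n + 1" "S = convex hull C"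
      then have "C \<noteq> {}" by auto
      with C show ?thesis by blast
    qed
  next
    assume "\<exists>C. finite C \<and> C \<noteq> {} \<and> \<not> affine_dependent C \<and> S = convex hull C"
    then obtain C where C: "finite C" "C \<noteq> {}" "\<not> affine_dependent C" "S = convex hull C"
      by blast
    then have "int (card C) = int (card C - 1) + 1"
      by (simp add: Suc_leI card_gt_0_iff of_nat_diff)
    with C show ?L
      unfolding simplex by blast
  qed
  also have "\<dots> \<longleftrightarrow> (\<exists>C. finite C \<and> C \<noteq> {} \<and> ?I C \<and> S = ?H C)"
    by (intro ex_cong1 conj_cong refl I) (assumption, subst H, assumption, rule refl)
  finally show ?thesis .
qed

text \<open>
  Unlike \<^const>\<open>face_of\<close>, this excludes the empty face. The vertex set \<open>C\<close> of a simplex is uniquely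
  determined by the simplex, so the existential quantifier involves no choice.
\<close>

definition simplex_face :: "'a::euclidean_space set \<Rightarrow> 'a set \<Rightarrow> bool" where
  "simplex_face T S \<longleftrightarrow>
    (\<exists>C D. finite C \<and> \<not> affine_dependent C \<and> S = convex hull C \<and>
           D \<subseteq> C \<and> D \<noteq> {} \<and> T = convex hull D)"

text \<open>
  The library's \<^const>\<open>simplicial_complex\<close> is restricted to finite collections and forces the
  empty simplex into every non-empty complex; here the collection may be infinite (and need not be
  locally finite), and all simplices are non-empty.
\<close>

definition geometric_complex :: "'a::euclidean_space set set \<Rightarrow> bool" where
  "geometric_complex K \<longleftrightarrow>
    K \<noteq> {} \<and>
    (\<forall>S\<in>K. \<exists>n::nat. int n simplex S) \<and>
    (\<forall>S\<in>K. \<forall>T. simplex_face T S \<longrightarrow> T \<in> K) \<and>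
    (\<forall>S\<in>K. \<forall>T\<in>K. S \<inter> T = {} \<or> simplex_face (S \<inter> T) S \<and> simplex_face (S \<inter> T) T)"

text \<open>
  The coherent (weak) topology on the union of \<open>K\<close>, in general finer than the subspace topology.
\<close>

definition underlying_space :: "'a::euclidean_space set set \<Rightarrow> 'a topology" where
  "underlying_space K =
    topology (\<lambda>U. U \<subseteq> \<Union>K \<and> (\<forall>S\<in>K. openin (top_of_set S) (U \<inter> S)))"

lemma openin_underlying_space:
  "openin (underlying_space K) U \<longleftrightarrow>
    U \<subseteq> \<Union>K \<and> (\<forall>S\<in>K. openin (top_of_set S) (U \<inter> S))"
proof -
  have "istopology (\<lambda>U. U \<subseteq> \<Union>K \<and> (\<forall>S\<in>K. openin (top_of_set S) (U \<inter> S)))"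
    unfolding istopology_def
  proof (intro conjI allI impI)
    fix U V
    assume U: "U \<subseteq> \<Union>K \<and> (\<forall>S\<in>K. openin (top_of_set S) (U \<inter> S))"
      and V: "V \<subseteq> \<Union>K \<and> (\<forall>S\<in>K. openin (top_of_set S) (V \<inter> S))"
    show "U \<inter> V \<subseteq> \<Union>K" using U by blast
    have "U \<inter> V \<inter> S = (U \<inter> S) \<inter> (V \<inter> S)" for S by blast
    then show "\<forall>S\<in>K. openin (top_of_set S) (U \<inter> V \<inter> S)"
      using U V by (metis openin_Int)
  next
    fix \<U>
    assume \<U>: "\<forall>U\<in>\<U>. U \<subseteq> \<Union>K \<and> (\<forall>S\<in>K. openin (top_of_set S) (U \<inter> S))"
    then show "\<Union>\<U> \<subseteq> \<Union>K" by blast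
    show "\<forall>S\<in>K. openin (top_of_set S) (\<Union>\<U> \<inter> S)"
      unfolding Int_Union2 using \<U> by blast
  qed
  then show ?thesis
    unfolding underlying_space_def by (subst topology_inverse') auto
qed

lemma topspace_underlying_space: "topspace (underlying_space K) = \<Union>K"
proof
  show "topspace (underlying_space K) \<subseteq> \<Union>K"
    using openin_topspace openin_underlying_space by blast
  have "\<Union>K \<inter> S = S" if "S \<in> K" for S using that by blast
  then have "openin (underlying_space K) (\<Union>K)"
    by (simp add: openin_underlying_space)
  then show "\<Union>K \<subseteq> topspace (underlying_space K)"
    by (rule openin_subset)
qed

end

theory Submission
  imports Defs
begin

text \<open>The preimage of an open \<open>U\<close> under the restriction of \<open>f\<close> to a
  simplex is the trace on it of the preimage under \<open>f\<close>. In the coherent topology a set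
  is open iff all its traces are, so both sides say that every such trace is open in its
  simplex.\<close>

theorem lemma4p14:
  fixes K :: "(real ^ 'N) set set"
    and X :: "'b topology"
    and f :: "real ^ 'N \<Rightarrow> 'b"
  assumes "geometric_complex K"
    and "f \<in> topspace (underlying_space K) \<rightarrow> topspace X"
  shows "continuous_map (underlying_space K) X f \<longleftrightarrow>
    (\<forall>\<sigma>\<in>K. continuous_map (top_of_set \<sigma>) X (restrict f \<sigma>))"
proof -
  \<comment> \<open>\<open>continuous_map\<close> also asks that values lie in
    \<open>topspace X\<close>.\<close>
  have maps: "f x \<in> topspace X" if "x \<in> \<Union>K" for x
    using assms(2) that by (auto simp: topspace_underlying_space)
  have preimage: "{x \<in> \<sigma>. restrict f \<sigma> x \<in> U} = {x \<in> \<Union>K. f x \<in> U} \<inter> \<sigma>"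
    if "\<sigma> \<in> K" for \<sigma> U
    using that by auto
  have restr: "continuous_map (top_of_set \<sigma>) X (restrict f \<sigma>) \<longleftrightarrow>
      (\<forall>U. openin X U \<longrightarrow> openin (top_of_set \<sigma>) ({x \<in> \<Union>K. f x \<in> U} \<inter> \<sigma>))"
    if "\<sigma> \<in> K" for \<sigma>
    \<comment> \<open>Unfolding \<open>restrict\<close> into a conditional would keep
      \<open>preimage\<close> from matching.\<close>
    using that maps by (auto simp: continuous_map_def preimage simp del: restrict_apply)
  have "continuous_map (underlying_space K) X f \<longleftrightarrow>
      (\<forall>U. openin X U \<longrightarrow> (\<forall>\<sigma>\<in>K. openin (top_of_set \<sigma>) ({x \<in> \<Union>K. f x \<in> U} \<inter> \<sigma>)))"
    using assms(2)
    by (auto simp: continuous_map_def topspace_underlying_space openin_underlying_space)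
  \<comment> \<open>Only the order of the quantifiers over \<open>U\<close> and
    \<open>\<sigma>\<close> still differs.\<close>
  with restr show ?thesis
    by blast
qed

end
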